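(* Let $\mathcal{H}$ be an infinite dimensional complex Hilbert space, let $T\in\mathcal{B}(\mathcal{H})$, and suppose $T=T^*C$ for some contraction $C\in\mathcal{B}(\mathcal{H})$ (that is, $\|C\|\leq 1$). Then $T$ is not weakly hypercyclic.
   Context: $\mathcal{B}(\mathcal{H})$ is the algebra of all bounded linear operators on $\mathcal{H}$. For $x\in\mathcal{H}$, $Orb(T,x)=\{T^n x: n\geq 0\}$. The operator $T$ is weakly hypercyclic if there is $x\in\mathcal{H}$ such that $Orb(T,x)$ is dense in $\mathcal{H}$ with respect to the weak topology. *)

theory Defs
  imports "HOL-Analysis.Analysis"
begin

section \<open>Complex Hilbert spaces\<close>

class complex_vector = real_vector +
  fixes scaleC :: "complex \<Rightarrow> 'a \<Rightarrow> 'a" (infixr \<open>*\<^sub>C\<close> 75)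
  assumes scaleC_add_right: "a *\<^sub>C (x + y) = a *\<^sub>C x + a *\<^sub>C y"
    and scaleC_add_left: "(a + b) *\<^sub>C x = a *\<^sub>C x + b *\<^sub>C x"
    and scaleC_scaleC: "a *\<^sub>C b *\<^sub>C x = (a * b) *\<^sub>C x"
    and scaleC_one: "1 *\<^sub>C x = x"
    and scaleR_scaleC: "r *\<^sub>R x = complex_of_real r *\<^sub>C x"

class complex_normed_vector = complex_vector + real_normed_vector +
  assumes norm_scaleC: "norm (a *\<^sub>C x) = cmod a * norm x"

text \<open>The inner product is linear in the first and conjugate-linear in the second argument.
  The inherited normed-space axioms are consequences of those listed here; they are
  inherited so that the library's norm, completeness and \<open>onorm\<close> are available.\<close>

class complex_inner = complex_normed_vector +
  fixes cinner :: "'a \<Rightarrow> 'a \<Rightarrow> complex"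
  assumes cinner_commute: "cinner x y = cnj (cinner y x)"
    and cinner_add_left: "cinner (x + y) z = cinner x z + cinner y z"
    and cinner_scaleC_left: "cinner (a *\<^sub>C x) y = a * cinner x y"
    and cinner_ge_zero: "0 \<le> Re (cinner x x)"
    and cinner_eq_zero_iff: "cinner x x = 0 \<longleftrightarrow> x = 0"
    and norm_eq_sqrt_cinner: "norm x = sqrt (Re (cinner x x))"

class complex_hilbert_space = complex_inner + complete_space

instantiation complex :: complex_hilbert_space
begin

definition scaleC_complex :: "complex \<Rightarrow> complex \<Rightarrow> complex"
  where "scaleC_complex a x = a * x"

definition cinner_complex :: "complex \<Rightarrow> complex \<Rightarrow> complex"
  where "cinner_complex x y = x * cnj y"

instance
proof
  fix a b x y z :: complex and r :: real
  show "a *\<^sub>C (x + y) = a *\<^sub>C x + a *\<^sub>C y" "(a + b) *\<^sub>C x = a *\<^sub>C x + b *\<^sub>C x"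
    "a *\<^sub>C b *\<^sub>C x = (a * b) *\<^sub>C x" "1 *\<^sub>C x = x"
    by (simp_all add: scaleC_complex_def algebra_simps)
  show "r *\<^sub>R x = complex_of_real r *\<^sub>C x"
    by (simp add: scaleC_complex_def scaleR_conv_of_real)
  show "norm (a *\<^sub>C x) = cmod a * norm x"
    by (simp add: scaleC_complex_def norm_mult)
  show "cinner x y = cnj (cinner y x)" "cinner (x + y) z = cinner x z + cinner y z"
    "cinner (a *\<^sub>C x) y = a * cinner x y" "cinner x x = 0 \<longleftrightarrow> x = 0"
    by (simp_all add: cinner_complex_def scaleC_complex_def algebra_simps)
  show "0 \<le> Re (cinner x x)"
    by (simp add: cinner_complex_def)
  show "norm x = sqrt (Re (cinner x x))"
    by (simp add: cinner_complex_def cmod_def power2_eq_square)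
qed

end

lemma vector_space_scaleC: "vector_space (scaleC :: complex \<Rightarrow> 'a \<Rightarrow> 'a::complex_vector)"
  by standard (simp_all add: scaleC_add_right scaleC_add_left scaleC_scaleC scaleC_one)

definition infinite_dimensional :: "'a::complex_vector itself \<Rightarrow> bool"
  where "infinite_dimensional _ \<longleftrightarrow>
    \<not> (\<exists>B :: 'a set. finite B \<and> module.span scaleC B = UNIV)"

section \<open>Bounded operators and adjoints\<close>

definition bounded_clinear :: "('a::complex_normed_vector \<Rightarrow> 'b::complex_normed_vector) \<Rightarrow> bool"
  where "bounded_clinear f \<longleftrightarrow>
    (\<forall>x y. f (x + y) = f x + f y) \<and>
    (\<forall>a x. f (a *\<^sub>C x) = a *\<^sub>C f x) \<and>
    (\<exists>K. \<forall>x. norm (f x) \<le> norm x * K)"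

lemma bounded_clinear_imp_bounded_linear:
  assumes "bounded_clinear f"
  shows "bounded_linear f"
  using assms unfolding bounded_clinear_def
  by (intro bounded_linear.intro bounded_linear_axioms.intro linearI)
    (auto simp: scaleR_scaleC)

text \<open>Existence and uniqueness of the adjoint of a bounded operator are proved below
  (\<open>cinner_cadjoint\<close>, \<open>cadjoint_unique\<close>, \<open>bounded_clinear_cadjoint\<close>).\<close>

definition cadjoint :: "('a::complex_inner \<Rightarrow> 'a) \<Rightarrow> 'a \<Rightarrow> 'a"
  where "cadjoint T = (THE S. \<forall>x y. cinner (T x) y = cinner x (S y))"

section \<open>Weak topology and weak hypercyclicity\<close>

definition weak_topology :: "'a::complex_normed_vector topology"
  where "weak_topology =
    topology_generated_by {f -` U | f U. bounded_clinear (f :: 'a \<Rightarrow> complex) \<and> open U}"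

lemma topspace_weak_topology [simp]:
  "topspace (weak_topology :: 'a::complex_normed_vector topology) = UNIV"
proof -
  have "bounded_clinear (\<lambda>_ :: 'a. 0 :: complex)"
    by (auto simp: bounded_clinear_def scaleC_complex_def intro: exI[of _ 0])
  then have "(\<lambda>_ :: 'a. 0 :: complex) -` UNIV \<in>
      {f -` U | f U. bounded_clinear (f :: 'a \<Rightarrow> complex) \<and> open U}"
    by blast
  then show ?thesis
    unfolding weak_topology_def topology_generated_by_topspace by blast
qed

definition orbit :: "('a \<Rightarrow> 'a) \<Rightarrow> 'a \<Rightarrow> 'a set"
  where "orbit T x = {(T ^^ n) x | n. True}"

definition weakly_hypercyclic :: "('a::complex_normed_vector \<Rightarrow> 'a) \<Rightarrow> bool"
  where "weakly_hypercyclic T \<longleftrightarrow> (\<exists>x. weak_topology closure_of orbit T x = UNIV)"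

section \<open>Well-definedness of the adjoint\<close>

lemma cinner_add_right: "cinner x (y + z) = cinner x y + cinner x z"
  for x :: "'a::complex_inner"
  unfolding cinner_commute[of x] by (simp add: cinner_add_left)

lemma cinner_scaleC_right: "cinner x (a *\<^sub>C y) = cnj a * cinner x y"
  for x :: "'a::complex_inner"
  unfolding cinner_commute[of x] by (simp add: cinner_scaleC_left)

lemma cinner_diff_right: "cinner x (y - z) = cinner x y - cinner x z"
  for x :: "'a::complex_inner"
  using cinner_add_right[of x "y - z" z] by simp

lemma cinner_self: "cinner x x = complex_of_real ((norm x)\<^sup>2)"
  for x :: "'a::complex_inner"
proof -
  have "Im (cinner x x) = 0"
    using arg_cong[OF cinner_commute[of x x], of Im] by simp
  then show ?thesis
    by (simp add: complex_eq_iff norm_eq_sqrt_cinner cinner_ge_zero)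
qed

lemma cinner_right_eqI:
  fixes y z :: "'a::complex_inner"
  assumes "\<And>x. cinner x y = cinner x z"
  shows "y = z"
  using assms[of "y - z"] cinner_eq_zero_iff[of "y - z"]
  by (simp add: cinner_diff_right)

lemma norm_add_sq: "(norm (x + y))\<^sup>2 = (norm x)\<^sup>2 + (norm y)\<^sup>2 + 2 * Re (cinner x y)"
  for x y :: "'a::complex_inner"
proof -
  have "Re (cinner y x) = Re (cinner x y)"
    by (subst cinner_commute) simp
  then show ?thesis
    using arg_cong[OF cinner_self[of "x + y"], of Re]
      arg_cong[OF cinner_self[of x], of Re] arg_cong[OF cinner_self[of y], of Re]
    by (simp add: cinner_add_left cinner_add_right)
qed

lemma Cauchy_Schwarz_cinner: "cmod (cinner x y) \<le> norm x * norm y"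
  for x y :: "'a::complex_inner"
proof -
  have Re_le: "Re (cinner u v) \<le> norm u * norm v" for u v :: 'a
  proof -
    have "(norm (u + v))\<^sup>2 \<le> (norm u + norm v)\<^sup>2"
      by (intro power_mono norm_triangle_ineq) simp
    then show ?thesis
      unfolding norm_add_sq by (simp add: power2_sum)
  qed
  define a where "a = cnj (sgn (cinner x y))"
  have "a * cinner x y = complex_of_real (cmod (cinner x y))"
  proof (cases "cinner x y = 0")
    case False
    have "a * cinner x y = (cinner x y * cnj (cinner x y)) / complex_of_real (cmod (cinner x y))"
      by (simp add: a_def sgn_eq)
    then show ?thesis
      using False by (simp add: complex_norm_square[symmetric] power2_eq_square)
  qed simp
  then have "cmod (cinner x y) = Re (cinner (a *\<^sub>C x) y)"
    by (simp add: cinner_scaleC_left)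
  also have "\<dots> \<le> norm (a *\<^sub>C x) * norm y"
    by (rule Re_le)
  also have "\<dots> \<le> norm x * norm y"
    by (simp add: norm_scaleC a_def norm_sgn)
  finally show ?thesis .
qed

lemma riesz_representation:
  fixes f :: "'a::complex_hilbert_space \<Rightarrow> complex"
  assumes "bounded_clinear f"
  shows "\<exists>u. \<forall>x. f x = cinner x u"
proof -
  interpret f: bounded_linear f
    by (rule bounded_clinear_imp_bounded_linear) fact
  define J where "J = (\<lambda>x. (norm x)\<^sup>2 - 2 * Re (f x))"
  obtain K where K: "\<And>x. norm (f x) \<le> norm x * K"
    using assms unfolding bounded_clinear_def by blast
  have J_lower: "- K\<^sup>2 \<le> J x" for x
  proof -
    have "Re (f x) \<le> norm x * K"
      using K[of x] complex_Re_le_cmod[of "f x"] by linarith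
    moreover have "0 \<le> (norm x - K)\<^sup>2"
      by simp
    ultimately show ?thesis
      unfolding J_def by (simp add: power2_diff)
  qed
  define m where "m = Inf (range J)"
  have bdd: "bdd_below (range J)"
    using J_lower by (intro bdd_belowI[of _ "- K\<^sup>2"]) auto
  have m_le: "m \<le> J x" for x
    unfolding m_def using bdd by (intro cInf_lower) auto
  have par: "(norm (x - y))\<^sup>2 \<le> 2 * J x + 2 * J y - 4 * m" for x y
  proof -
    have 1: "(norm (x - y))\<^sup>2 + (norm (x + y))\<^sup>2 = 2 * (norm x)\<^sup>2 + 2 * (norm y)\<^sup>2"
    proof -
      have "cinner x (- y) = - cinner x y"
        using cinner_diff_right[of x 0 y] cinner_diff_right[of x 0 0] by simp
      then show ?thesis
        using norm_add_sq[of x y] norm_add_sq[of x "- y"] by simp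
    qed
    have "(norm ((1/2) *\<^sub>R (x + y)))\<^sup>2 = (norm (x + y))\<^sup>2 / 4"
      by (simp only: norm_scaleR power_mult_distrib) (simp add: power_divide)
    moreover have "Re (f ((1/2) *\<^sub>R (x + y))) = (Re (f x) + Re (f y)) / 2"
      by (simp only: f.scaleR f.add) simp
    ultimately have "4 * J ((1/2) *\<^sub>R (x + y)) = (norm (x + y))\<^sup>2 - 4 * Re (f x) - 4 * Re (f y)"
      unfolding J_def by simp
    with 1 m_le[of "(1/2) *\<^sub>R (x + y)"] show ?thesis
      by (simp add: J_def)
  qed
  have "\<exists>x. J x < m + 1 / real (Suc n)" for n
  proof -
    have "Inf (range J) < m + 1 / real (Suc n)"
      by (simp add: m_def)
    then show ?thesis
      by (subst (asm) cInf_less_iff) (use bdd in auto)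
  qed
  then obtain X where X: "\<And>n. J (X n) < m + 1 / real (Suc n)"
    by metis
  have "Cauchy X"
  proof (rule CauchyI)
    fix e :: real
    assume "0 < e"
    then obtain N where N: "4 / e\<^sup>2 < real N"
      using reals_Archimedean2 by blast
    have "norm (X i - X j) < e" if "N \<le> i" "N \<le> j" for i j
    proof -
      have "1 / real (Suc i) \<le> 1 / real (Suc N)" "1 / real (Suc j) \<le> 1 / real (Suc N)"
        using that by (auto intro!: divide_left_mono)
      then have "(norm (X i - X j))\<^sup>2 < 4 * (1 / real (Suc N))"
        using par[of "X i" "X j"] X[of i] X[of j] by linarith
      also have "\<dots> < e\<^sup>2"
      proof -
        have "4 < real N * e\<^sup>2"
          using N \<open>0 < e\<close> by (simp add: pos_divide_less_eq)
        also have "\<dots> \<le> real (Suc N) * e\<^sup>2"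
          by (intro mult_right_mono) simp_all
        finally show ?thesis
          by (simp add: pos_divide_less_eq mult.commute)
      qed
      finally show ?thesis
        using \<open>0 < e\<close> by (simp add: power_less_imp_less_base)
    qed
    then show "\<exists>M. \<forall>i\<ge>M. \<forall>j\<ge>M. norm (X i - X j) < e"
      by blast
  qed
  then obtain u where u: "X \<longlonglongrightarrow> u"
    using Cauchy_convergent convergent_def by blast
  have "(\<lambda>n. J (X n)) \<longlonglongrightarrow> J u"
    unfolding J_def by (intro tendsto_intros u f.tendsto)
  moreover have "(\<lambda>n. m + 1 / real (Suc n)) \<longlonglongrightarrow> m + 0"
    by (intro tendsto_intros LIMSEQ_Suc[OF lim_1_over_n])
  ultimately have Ju: "J u \<le> m"
    using X by (intro LIMSEQ_le[of "\<lambda>n. J (X n)" "J u" "\<lambda>n. m + 1 / real (Suc n)" m])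
      (auto intro: less_imp_le)
  have Re_eq: "Re (f v) = Re (cinner v u)" for v
  proof -
    define b where "b = Re (cinner v u) - Re (f v)"
    have sym: "Re (cinner u v) = Re (cinner v u)"
      by (subst cinner_commute) simp
    have ineq: "0 \<le> t\<^sup>2 * (norm v)\<^sup>2 + 2 * t * b" for t :: real
    proof -
      have "cinner u (t *\<^sub>R v) = t * cinner u v"
        by (simp add: scaleR_scaleC cinner_scaleC_right)
      moreover have "f (t *\<^sub>R v) = t * f v"
        by (simp add: f.scaleR scaleR_conv_of_real)
      moreover have "J u \<le> J (u + t *\<^sub>R v)"
        using Ju m_le order_trans by blast
      ultimately show ?thesis
        unfolding J_def b_def norm_add_sq
        by (simp add: f.add sym power_mult_distrib algebra_simps)
    qed
    define q where "q = (norm v)\<^sup>2 + 1"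
    have q: "q > 0"
      unfolding q_def by (simp add: add_nonneg_pos)
    have "0 \<le> (- b / q)\<^sup>2 * (q - 1) + 2 * (- b / q) * b"
      using ineq[of "- b / q"] unfolding q_def by simp
    also have "\<dots> = - (b\<^sup>2 * (q + 1) / q\<^sup>2)"
      using q by (simp add: field_simps power2_eq_square)
    finally have "b\<^sup>2 * (q + 1) / q\<^sup>2 \<le> 0"
      by simp
    then have "b = 0"
      using q by (auto simp: divide_le_0_iff mult_le_0_iff)
    then show ?thesis
      by (simp add: b_def)
  qed
  have "f v = cinner v u" for v
  proof (rule complex_eqI)
    show "Re (f v) = Re (cinner v u)"
      by (rule Re_eq)
    have "f (\<i> *\<^sub>C v) = \<i> * f v"
      using assms unfolding bounded_clinear_def scaleC_complex_def by blast
    then show "Im (f v) = Im (cinner v u)"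
      using Re_eq[of "\<i> *\<^sub>C v"] by (simp add: cinner_scaleC_left)
  qed
  then show ?thesis
    by blast
qed

lemma cadjoint_unique:
  fixes T :: "'a::complex_inner \<Rightarrow> 'a"
  assumes adj: "\<And>x y. cinner (T x) y = cinner x (S y)"
  shows "cadjoint T = S"
  unfolding cadjoint_def
proof (rule the_equality)
  show "\<forall>x y. cinner (T x) y = cinner x (S y)"
    using adj by blast
  fix S'
  assume S': "\<forall>x y. cinner (T x) y = cinner x (S' y)"
  show "S' = S"
  proof
    fix y
    show "S' y = S y"
    proof (rule cinner_right_eqI)
      show "cinner x (S' y) = cinner x (S y)" for x
        using S' adj[of x y] by metis
    qed
  qed
qed

lemma cinner_cadjoint:
  fixes T :: "'a::complex_hilbert_space \<Rightarrow> 'a"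
  assumes "bounded_clinear T"
  shows "cinner (T x) y = cinner x (cadjoint T y)"
proof -
  obtain K where K: "\<And>x. norm (T x) \<le> norm x * K"
    using assms unfolding bounded_clinear_def by blast
  have "\<exists>u. \<forall>x. cinner (T x) y = cinner x u" for y
  proof (rule riesz_representation)
    have "norm (cinner (T x) y) \<le> norm x * (K * norm y)" for x
      using order_trans[OF Cauchy_Schwarz_cinner mult_right_mono[OF K norm_ge_zero]]
      by (simp add: mult.assoc)
    then have "\<exists>K. \<forall>x. norm (cinner (T x) y) \<le> norm x * K"
      by blast
    with assms show "bounded_clinear (\<lambda>x. cinner (T x) y)"
      by (simp add: bounded_clinear_def cinner_add_left cinner_scaleC_left scaleC_complex_def)
  qed
  then obtain S where S: "\<And>x y. cinner (T x) y = cinner x (S y)"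
    by metis
  then show ?thesis
    using cadjoint_unique[of T S] by simp
qed

lemma bounded_clinear_cadjoint:
  fixes T :: "'a::complex_hilbert_space \<Rightarrow> 'a"
  assumes "bounded_clinear T"
  shows "bounded_clinear (cadjoint T)"
proof -
  note adj = cinner_cadjoint[OF assms, symmetric]
  obtain K where K: "\<And>x. norm (T x) \<le> norm x * K"
    using assms unfolding bounded_clinear_def by blast
  have "norm (cadjoint T y) \<le> norm y * K" for y
  proof (cases "cadjoint T y = 0")
    case True
    have "0 \<le> norm y * K"
      using order_trans[OF norm_ge_zero K] .
    with True show ?thesis
      by simp
  next
    case False
    let ?z = "cadjoint T y"
    have "norm ?z * norm ?z = cmod (cinner (T ?z) y)"
      unfolding cinner_cadjoint[OF assms] cinner_self norm_of_real
      by (simp add: power2_eq_square)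
    also have "\<dots> \<le> norm (T ?z) * norm y"
      by (rule Cauchy_Schwarz_cinner)
    also have "\<dots> \<le> norm ?z * K * norm y"
      by (intro mult_right_mono K) simp
    finally have "norm ?z * norm ?z \<le> norm ?z * (norm y * K)"
      by (simp only: mult.assoc mult.commute[of K])
    then show ?thesis
      using False by simp
  qed
  moreover have "cadjoint T (y + z) = cadjoint T y + cadjoint T z" for y z
    by (rule cinner_right_eqI) (simp add: adj cinner_add_right)
  moreover have "cadjoint T (a *\<^sub>C y) = a *\<^sub>C cadjoint T y" for a y
    by (rule cinner_right_eqI) (simp add: adj cinner_scaleC_right)
  ultimately show ?thesis
    unfolding bounded_clinear_def by blast
qed

end

theory Submission
  imports Defs
begin

text \<open>
  Taking adjoints in \<open>T = T\<^sup>* C\<close> gives \<open>T\<^sup>* = C\<^sup>* T\<close>, so that \<open>\<parallel>T\<^sup>* x\<parallel> \<le> \<parallel>T x\<parallel>\<close> for all \<open>x\<close>: the operator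
  \<open>T\<close> is hyponormal. Hence \<open>\<parallel>T x\<parallel>\<^sup>2 = \<langle>T\<^sup>* T x, x\<rangle> \<le> \<parallel>T (T x)\<parallel> \<parallel>x\<parallel>\<close>, which says that the norms
  \<open>\<parallel>T\<^sup>n x\<parallel>\<close> form a log-convex sequence. Such a sequence either never increases, or from some index
  on it grows at least geometrically.

  In the first case the orbit is bounded and therefore is not weakly dense in a nonzero space. In the
  second case no \<open>T\<^sup>n x\<close> vanishes and \<open>\<Sum>n. 1 / \<parallel>T\<^sup>n x\<parallel>\<close> converges (\<open>log_convex_growth\<close>). Bang's
  lemma for sequences (\<open>Bang_lemma\<close>, rescaled in \<open>exists_vector_outside_planks\<close>) then provides a single vector \<open>y\<close> with
  \<open>\<bar>Re \<langle>T\<^sup>n x, y\<rangle>\<bar> \<ge> 1\<close> for all \<open>n\<close>, so that \<open>0\<close> is not in the weak closure of the orbit.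
\<close>

instance complex_hilbert_space \<subseteq> banach ..

section \<open>Inner products\<close>

lemma bounded_clinear_cinner_left:
  "bounded_clinear (\<lambda>x. cinner x y)" for y :: "'a::complex_inner"
proof -
  have "\<exists>K. \<forall>x. norm (cinner x y) \<le> norm x * K"
    using Cauchy_Schwarz_cinner by blast
  then show ?thesis
    by (simp add: bounded_clinear_def cinner_add_left cinner_scaleC_left scaleC_complex_def)
qed

lemma Re_cinner_commute: "Re (cinner x y) = Re (cinner y x)" for x :: "'a::complex_inner"
  by (subst cinner_commute) simp

lemma Re_cinner_scaleR_right: "Re (cinner x (r *\<^sub>R y)) = r * Re (cinner x y)"
  for x :: "'a::complex_inner"
  by (simp add: scaleR_scaleC cinner_scaleC_right)

section \<open>Bang's lemma for sequences\<close>

lemma compact_signs: "compact {e :: nat \<Rightarrow> real. \<forall>i. e i \<in> {-1, 1}}"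
proof -
  have "compactin (product_topology (\<lambda>i. euclidean) UNIV) (PiE UNIV (\<lambda>i::nat. {-1, 1::real}))"
    by (simp add: compactin_PiE)
  moreover have "PiE UNIV (\<lambda>i::nat. {-1, 1::real}) = {e. \<forall>i. e i \<in> {-1, 1}}"
    by (auto simp: PiE_def)
  ultimately show ?thesis
    by (simp add: euclidean_product_topology)
qed

text \<open>Bang's lemma for infinitely many vectors. The signs \<open>e\<close> are chosen to maximise
  \<open>\<parallel>\<Sum>i. e i v\<^sub>i\<parallel>\<close>; the claim follows because changing the sign of one term cannot increase this
  norm. A maximiser exists because the sum depends continuously on \<open>e\<close> in the compact
  space \<open>{-1, 1}\<^sup>\<nat>\<close>.\<close>

lemma Bang_lemma:
  fixes v :: "nat \<Rightarrow> 'a::complex_hilbert_space"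
  assumes summ: "summable (\<lambda>i. norm (v i))"
  obtains y where "\<And>j. (norm (v j))\<^sup>2 \<le> \<bar>Re (cinner y (v j))\<bar>"
proof -
  let ?E = "{e :: nat \<Rightarrow> real. \<forall>i. e i \<in> {-1, 1}}"
  define S where "S e = (\<Sum>i. e i *\<^sub>R v i)" for e :: "nat \<Rightarrow> real"
  have norm_le: "norm (e i *\<^sub>R v i) \<le> norm (v i)" if "e \<in> ?E" for e i
  proof -
    have "\<bar>e i\<bar> = 1"
      using that by (auto dest: spec[of _ i])
    then show ?thesis
      by simp
  qed
  have sums_S: "(\<lambda>i. e i *\<^sub>R v i) sums S e" if "e \<in> ?E" for e
    unfolding S_def
    by (intro summable_sums summable_comparison_test'[OF summ, of 0] norm_le that)
  have "continuous_on ?E S"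
  proof (rule uniform_limit_theorem)
    show "uniform_limit ?E (\<lambda>n e. \<Sum>i<n. e i *\<^sub>R v i) S sequentially"
      unfolding S_def using norm_le summ by (rule Weierstrass_m_test)
    have "continuous_on ?E (\<lambda>e. e i)" for i
      using continuous_on_product_coordinates by (rule continuous_on_subset) simp
    then show "\<forall>\<^sub>F n in sequentially. continuous_on ?E (\<lambda>e. \<Sum>i<n. e i *\<^sub>R v i)"
      by (intro always_eventually allI continuous_intros)
  qed simp
  then have "continuous_on ?E (\<lambda>e. norm (S e))"
    by (rule continuous_on_norm)
  moreover have "?E \<noteq> {}"
    by (auto intro: exI[of _ "\<lambda>_. 1"])
  ultimately have "\<exists>e\<in>?E. \<forall>e'\<in>?E. norm (S e') \<le> norm (S e)"
    using compact_signs by (intro continuous_attains_sup)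
  then obtain e where e: "e \<in> ?E" and max: "\<And>e'. e' \<in> ?E \<Longrightarrow> norm (S e') \<le> norm (S e)"
    by blast
  have "(norm (v j))\<^sup>2 \<le> \<bar>Re (cinner (S e) (v j))\<bar>" for j
  proof -
    define e' where "e' = e(j := - e j)"
    have "e j = -1 \<or> e j = 1"
      using e by simp
    then have ej: "\<bar>e j\<bar> = 1" and "- e j = -1 \<or> - e j = 1"
      by auto
    with e have e': "e' \<in> ?E"
      by (simp add: e'_def)
    have "(\<lambda>i. e i *\<^sub>R v i + (if i = j then (- 2 * e i) *\<^sub>R v i else 0)) sums
        (S e + (- 2 * e j) *\<^sub>R v j)"
      by (intro sums_add sums_S e sums_single)
    moreover have "(\<lambda>i. e i *\<^sub>R v i + (if i = j then (- 2 * e i) *\<^sub>R v i else 0)) = (\<lambda>i. e' i *\<^sub>R v i)"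
      by (auto simp: e'_def fun_eq_iff simp flip: scaleR_left_diff_distrib)
    ultimately have "S e' = S e + (- 2 * e j) *\<^sub>R v j"
      using sums_unique2[OF sums_S[OF e']] by simp
    then have "(norm (S e'))\<^sup>2 =
        (norm (S e))\<^sup>2 + (norm ((- 2 * e j) *\<^sub>R v j))\<^sup>2 + 2 * Re (cinner (S e) ((- 2 * e j) *\<^sub>R v j))"
      by (simp only: norm_add_sq)
    also have "\<dots> = (norm (S e))\<^sup>2 + 4 * (norm (v j))\<^sup>2 - 4 * (e j * Re (cinner (S e) (v j)))"
      using ej unfolding Re_cinner_scaleR_right norm_scaleR by (simp add: abs_mult power_mult_distrib)
    finally have "(norm (v j))\<^sup>2 \<le> e j * Re (cinner (S e) (v j))"
      using power_mono[OF max[OF e'] norm_ge_zero, of 2] by simp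
    also have "\<dots> \<le> \<bar>e j\<bar> * \<bar>Re (cinner (S e) (v j))\<bar>"
      by (metis abs_ge_self abs_mult)
    finally show ?thesis
      using ej by simp
  qed
  then show ?thesis
    using that by blast
qed

text \<open>Planks \<open>{y. \<bar>Re \<langle>x\<^sub>n, y\<rangle>\<bar> < 1}\<close> of summable widths \<open>2 / \<parallel>x\<^sub>n\<parallel>\<close> do not cover the space.\<close>

lemma exists_vector_outside_planks:
  fixes x :: "nat \<Rightarrow> 'a::complex_hilbert_space"
  assumes nz: "\<And>n. x n \<noteq> 0" and summ: "summable (\<lambda>n. 1 / norm (x n))"
  obtains y where "\<And>n. 1 \<le> \<bar>Re (cinner (x n) y)\<bar>"
proof -
  \<comment> \<open>The normalisation turns the bound \<open>\<parallel>v\<^sub>n\<parallel>\<^sup>2\<close> in Bang's lemma into \<open>1\<close> after rescaling.\<close>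
  define v where "v n = (1 / (norm (x n))\<^sup>2) *\<^sub>R x n" for n
  have norm_v: "norm (v n) = 1 / norm (x n)" for n
    using nz[of n] by (simp add: v_def power2_eq_square)
  obtain y where y: "\<And>n. (norm (v n))\<^sup>2 \<le> \<bar>Re (cinner y (v n))\<bar>"
    using Bang_lemma[of v] summ unfolding norm_v by blast
  have "1 \<le> \<bar>Re (cinner (x n) y)\<bar>" for n
  proof -
    have "1 / (norm (x n))\<^sup>2 \<le> \<bar>Re (cinner y (x n))\<bar> / (norm (x n))\<^sup>2"
      using y[of n] unfolding norm_v
      by (simp add: v_def Re_cinner_scaleR_right abs_mult power_divide)
    then show ?thesis
      using nz[of n] by (simp add: divide_le_cancel Re_cinner_commute[of y])
  qed
  then show ?thesis
    using that by blast
qed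

section \<open>Log-convex sequences\<close>

text \<open>The ratios of a log-convex sequence never decrease, so one strict increase forces geometric growth
  from there on; and a zero would propagate to all later indices.\<close>

lemma log_convex_growth:
  fixes a :: "nat \<Rightarrow> real"
  assumes nonneg: "\<And>n. 0 \<le> a n" and convex: "\<And>n. (a (Suc n))\<^sup>2 \<le> a n * a (Suc (Suc n))"
    and less: "a m < a (Suc m)"
  shows "0 < a n" and "summable (\<lambda>n. 1 / a n)"
proof -
  have zero_stays: "a k = 0" if "a n = 0" "n \<le> k" for n k
    using that(2,1)
  proof (induction k rule: dec_induct)
    case (step k)
    then show ?case
      using convex[of k] by simp
  qed
  have am: "0 < a m"
    using zero_stays[of m "Suc m"] nonneg[of m] less by fastforce
  define c where "c = a (Suc m) / a m"
  have c: "1 < c"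
    using am less by (simp add: c_def)
  have growth: "0 < a n \<and> c * a n \<le> a (Suc n)" if "m \<le> n" for n
    using that
  proof (induction n rule: dec_induct)
    case base
    then show ?case
      using am by (simp add: c_def)
  next
    case (step n)
    then have n: "0 < a n" "c * a n \<le> a (Suc n)"
      by auto
    then have pos: "0 < a (Suc n)"
      using c by (auto intro: less_le_trans[of 0 "c * a n"])
    have "a n * (c * a (Suc n)) \<le> a (Suc n) * a (Suc n)"
      using mult_right_mono[OF n(2), of "a (Suc n)"] pos by (simp add: mult.left_commute mult.assoc)
    also have "\<dots> \<le> a n * a (Suc (Suc n))"
      using convex[of n] by (simp add: power2_eq_square)
    finally show ?case
      using n pos by simp
  qed
  have "a (max m n) \<noteq> 0"
    using growth[of "max m n"] by simp
  then show "0 < a n"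
    using zero_stays[of n "max m n"] nonneg[of n] by fastforce
  show "summable (\<lambda>n. 1 / a n)"
  proof (rule summable_ratio_test)
    show "1 / c < 1"
      using c by simp
    fix n
    assume "m \<le> n"
    with growth have n: "0 < a n" "c * a n \<le> a (Suc n)"
      by auto
    have "1 / a (Suc n) \<le> 1 / (c * a n)"
      using n c by (intro divide_left_mono mult_pos_pos) (auto intro: less_le_trans[of 0 "c * a n"])
    moreover have "0 \<le> a (Suc n)" "0 \<le> a n"
      using nonneg by auto
    ultimately show "norm (1 / a (Suc n)) \<le> 1 / c * norm (1 / a n)"
      by simp
  qed
qed

section \<open>Hyponormality\<close>

lemma norm_cadjoint_le:
  fixes T C :: "'a::complex_hilbert_space \<Rightarrow> 'a"
  assumes T: "bounded_clinear T" and C: "\<And>z. norm (C z) \<le> norm z"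
    and eq: "T = cadjoint T \<circ> C"
  shows "norm (cadjoint T z) \<le> norm (T z)"
proof -
  let ?u = "cadjoint T z"
  have "cinner ?u ?u = cinner (T ?u) z"
    by (simp add: cinner_cadjoint[OF T])
  also have "\<dots> = cinner (cadjoint T (C ?u)) z"
    by (subst eq) simp
  also have "\<dots> = cinner (C ?u) (T z)"
    by (metis cinner_cadjoint[OF T] cinner_commute)
  finally have "cmod (cinner ?u ?u) \<le> norm (C ?u) * norm (T z)"
    by (simp add: Cauchy_Schwarz_cinner)
  also have "\<dots> \<le> norm ?u * norm (T z)"
    using C by (intro mult_right_mono) simp_all
  finally have "norm ?u * norm ?u \<le> norm ?u * norm (T z)"
    unfolding cinner_self norm_of_real by (simp add: power2_eq_square)
  then show ?thesis
    by (cases "?u = 0") simp_all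
qed

lemma hyponormal_norm_sq_le:
  fixes T :: "'a::complex_hilbert_space \<Rightarrow> 'a"
  assumes T: "bounded_clinear T" and hypo: "\<And>z. norm (cadjoint T z) \<le> norm (T z)"
  shows "(norm (T x))\<^sup>2 \<le> norm x * norm (T (T x))"
proof -
  have "(norm (T x))\<^sup>2 = cmod (cinner x (cadjoint T (T x)))"
    unfolding cinner_cadjoint[OF T, symmetric] cinner_self norm_of_real by simp
  also have "\<dots> \<le> norm x * norm (cadjoint T (T x))"
    by (rule Cauchy_Schwarz_cinner)
  also have "\<dots> \<le> norm x * norm (T (T x))"
    using hypo by (intro mult_left_mono) simp_all
  finally show ?thesis .
qed

section \<open>Weakly dense sets\<close>

lemma openin_weak_topology_Re_cinner:
  fixes y :: "'a::complex_inner"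
  assumes "open U"
  shows "openin weak_topology {z. Re (cinner z y) \<in> U}"
proof -
  have "{z. Re (cinner z y) \<in> U} = (\<lambda>z. cinner z y) -` (Re -` U)"
    by auto
  moreover have "open (Re -` U)"
    using assms by (intro open_vimage continuous_intros)
  ultimately show ?thesis
    unfolding weak_topology_def
    using bounded_clinear_cinner_left by (intro topology_generated_by_Basis) blast
qed

lemma weakly_dense_meets:
  fixes y z :: "'a::complex_inner" and A :: "'a set"
  assumes "weak_topology closure_of A = UNIV" and "open U" and "Re (cinner z y) \<in> U"
  obtains p where "p \<in> A" "Re (cinner p y) \<in> U"
proof -
  have "z \<in> weak_topology closure_of A"
    using assms(1) by simp
  moreover have "z \<in> {q. Re (cinner q y) \<in> U}"
    using assms(3) by simp
  ultimately obtain p where "p \<in> A" "p \<in> {q. Re (cinner q y) \<in> U}"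
    using openin_weak_topology_Re_cinner[OF assms(2)] unfolding in_closure_of by metis
  then show ?thesis
    using that by simp
qed

lemma bounded_not_weakly_dense:
  fixes w :: "'a::complex_inner" and A :: "'a set"
  assumes "w \<noteq> 0" and bound: "\<And>p. p \<in> A \<Longrightarrow> norm p \<le> M"
  shows "weak_topology closure_of A \<noteq> UNIV"
proof
  assume dense: "weak_topology closure_of A = UNIV"
  \<comment> \<open>The real part of the inner product with \<open>w\<close> is at most \<open>M \<parallel>w\<parallel>\<close> on \<open>A\<close>, but exceeds
    this number at a large multiple of \<open>w\<close>.\<close>
  define t where "t = (M * norm w + 1) / (norm w)\<^sup>2"
  have "Re (cinner (t *\<^sub>R w) w) = t * (norm w)\<^sup>2"
    by (simp add: Re_cinner_commute[of "t *\<^sub>R w"] Re_cinner_scaleR_right cinner_self)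
  also have "\<dots> = M * norm w + 1"
    using \<open>w \<noteq> 0\<close> by (simp add: t_def)
  finally have "Re (cinner (t *\<^sub>R w) w) \<in> {M * norm w <..}"
    by simp
  then obtain p where p: "p \<in> A" "M * norm w < Re (cinner p w)"
    using weakly_dense_meets[OF dense open_greaterThan] by blast
  have "Re (cinner p w) \<le> norm p * norm w"
    using complex_Re_le_cmod Cauchy_Schwarz_cinner by (rule order_trans)
  also have "\<dots> \<le> M * norm w"
    using bound[OF p(1)] by (rule mult_right_mono) simp
  finally show False
    using p(2) by simp
qed

lemma infinite_dimensional_nonzero:
  assumes "infinite_dimensional TYPE('a::complex_vector)"
  obtains w :: "'a::complex_vector" where "w \<noteq> 0"
proof -
  interpret vector_space "scaleC :: complex \<Rightarrow> 'a \<Rightarrow> 'a"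
    by (rule vector_space_scaleC)
  have "span {} \<noteq> (UNIV :: 'a set)"
    using assms unfolding infinite_dimensional_def by blast
  then show ?thesis
    using that by auto
qed

section \<open>Orbits of hyponormal operators\<close>

theorem theorem2p6:
  fixes T C :: "'a::complex_hilbert_space \<Rightarrow> 'a"
  assumes "infinite_dimensional TYPE('a)"
    and "bounded_clinear T"
    and "bounded_clinear C"
    and "onorm C \<le> 1"
    and "T = cadjoint T \<circ> C"
  shows "\<not> weakly_hypercyclic T"
proof
  assume "weakly_hypercyclic T"
  then obtain x where dense: "weak_topology closure_of orbit T x = UNIV"
    unfolding weakly_hypercyclic_def by blast
  have "norm (C z) \<le> norm z" for z
  proof -
    have "norm (C z) \<le> onorm C * norm z"
      by (intro onorm bounded_clinear_imp_bounded_linear assms)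
    also have "\<dots> \<le> norm z"
      using assms(4) by (simp add: mult_left_le_one_le onorm_pos_le
          bounded_clinear_imp_bounded_linear[OF assms(3)])
    finally show ?thesis .
  qed
  then have hypo: "norm (cadjoint T z) \<le> norm (T z)" for z
    using norm_cadjoint_le assms(2,5) by blast
  define a where "a n = norm ((T ^^ n) x)" for n
  have convex: "(a (Suc n))\<^sup>2 \<le> a n * a (Suc (Suc n))" for n
    using hyponormal_norm_sq_le[OF assms(2) hypo] by (simp add: a_def)
  have nonneg: "0 \<le> a n" for n
    by (simp add: a_def)
  show False
  proof (cases "\<exists>m. a m < a (Suc m)")
    case False
    then have "decseq a"
      by (intro decseq_SucI) (auto simp: not_less)
    then have "a n \<le> a 0" for n
      by (rule decseqD) simp
    then have "norm p \<le> norm x" if "p \<in> orbit T x" for p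
      using that by (auto simp: orbit_def a_def)
    moreover obtain w :: 'a where "w \<noteq> 0"
      using infinite_dimensional_nonzero[OF assms(1)] .
    ultimately show False
      using bounded_not_weakly_dense dense by blast
  next
    case True
    then obtain m where m: "a m < a (Suc m)" ..
    have nz: "(T ^^ n) x \<noteq> 0" for n
      using log_convex_growth(1)[of a m n, OF nonneg convex m] by (simp add: a_def)
    have "summable (\<lambda>n. 1 / norm ((T ^^ n) x))"
      using log_convex_growth(2)[of a m, OF nonneg convex m] by (simp add: a_def)
    with nz obtain y where y: "\<And>n. 1 \<le> \<bar>Re (cinner ((T ^^ n) x) y)\<bar>"
      using exists_vector_outside_planks[of "\<lambda>n. (T ^^ n) x"] by blast
    have "cinner 0 y = 0"
      using cinner_add_left[of 0 0 y] by simp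
    then obtain p where "p \<in> orbit T x" "Re (cinner p y) \<in> {-1<..<1}"
      using weakly_dense_meets[OF dense open_greaterThanLessThan, of 0 y "-1" 1] by auto
    then obtain n where "\<bar>Re (cinner ((T ^^ n) x) y)\<bar> < 1"
      by (auto simp: orbit_def abs_less_iff)
    with y[of n] show False
      by simp
  qed
qed

end
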